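(* For any integers $2 \leq k \leq d$ there exist functions $\Phi_i : \mathbb{Z}^k \to \mathbb{Z}$, $1 \leq i \leq d$, each non-decreasing in each variable, such that the basis $\mathcal{B}$ consisting of all dyadic intervals in $\mathbb{R}^d$ of dimensions $$2^{\Phi_1(m)} \times \dots \times 2^{\Phi_d(m)} \quad \text{for some } m \in \mathbb{Z}^k$$ does not differentiate $L(\log^+ L)^{d-2}$.
   Context: An interval in $\mathbb{R}^d$ is a cartesian product of $d$ bounded one-dimensional intervals, and it has dimensions $\ell_1 \times \dots \times \ell_d$ if its $i$-th factor has length $\ell_i$. A dyadic interval in $\mathbb{R}^d$ is a product $\prod_{i=1}^d [j_i 2^{n_i}, (j_i+1)2^{n_i})$ with $j_i, n_i \in \mathbb{Z}$ (the $n_i$ may differ from one another). A basis is a collection of bounded measurable subsets of $\mathbb{R}^d$. A basis $\mathcal{B}$ differentiates a function space $X$ if for every $f \in X$, for almost every $x$, $$\lim_{j\to\infty} \frac{1}{|R_j|}\int_{R_j} f(y)\,dy = f(x)$$ for every sequence $\{R_j\}$ of elements of $\mathcal{B}$ containing $x$ and with diameters converging to $0$. For $\alpha \ge 0$, $L(\log^+ L)^{\alpha}$ is the space of measurable functions $f$ on $\mathbb{R}^d$ with $\int_{\mathbb{R}^d} |f|\,(1+\log^+|f|)^{\alpha} < \infty$, where $\log^+ u = \max(\log u, 0)$; for $\alpha = 0$ it is $L^1(\mathbb{R}^d)$. *)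

theory Defs
  imports "HOL-Analysis.Analysis"
begin

definition box_of :: "('d::finite \<Rightarrow> real set) \<Rightarrow> (real ^ 'd) set" where
  "box_of I = {x. \<forall>i. x $ i \<in> I i}"

definition dyadic_factor :: "int \<Rightarrow> int \<Rightarrow> real set" where
  "dyadic_factor j n = {of_int j * 2 powi n ..< (of_int j + 1) * 2 powi n}"

definition dyadic_interval :: "(real ^ 'd::finite) set \<Rightarrow> bool" where
  "dyadic_interval R \<longleftrightarrow> (\<exists>j n. R = box_of (\<lambda>i. dyadic_factor (j i) (n i)))"

definition has_dimensions :: "(real ^ 'd::finite) set \<Rightarrow> ('d \<Rightarrow> real) \<Rightarrow> bool" where
  "has_dimensions R l \<longleftrightarrow>
     (\<exists>I. (\<forall>i. is_interval (I i) \<and> bounded (I i) \<and> measure lborel (I i) = l i) \<and> R = box_of I)"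

definition is_basis :: "(real ^ 'd::finite) set set \<Rightarrow> bool" where
  "is_basis B \<longleftrightarrow> (\<forall>R\<in>B. bounded R \<and> R \<in> sets lebesgue)"

definition differentiates ::
  "(real ^ 'd::finite) set set \<Rightarrow> (real ^ 'd \<Rightarrow> real) set \<Rightarrow> bool" where
  "differentiates B X \<longleftrightarrow>
     (\<forall>f\<in>X. AE x in lebesgue. \<forall>R :: nat \<Rightarrow> (real ^ 'd) set.
        (\<forall>j. R j \<in> B \<and> x \<in> R j) \<longrightarrow> (\<lambda>j. diameter (R j)) \<longlonglongrightarrow> 0 \<longrightarrow>
        (\<lambda>j. (1 / measure lebesgue (R j)) * (LINT y:R j|lebesgue. f y)) \<longlonglongrightarrow> f x)"

definition log_plus :: "real \<Rightarrow> real" where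
  "log_plus u = max (ln u) 0"

definition L_log_L :: "real \<Rightarrow> (real ^ 'd::finite \<Rightarrow> real) set" where
  "L_log_L \<alpha> = {f \<in> borel_measurable lebesgue.
     (\<integral>\<^sup>+ x. ennreal (\<bar>f x\<bar> * (1 + log_plus \<bar>f x\<bar>) powr \<alpha>) \<partial>lebesgue) < \<infinity>}"

text \<open>A point of \<open>\<int>\<^sup>k\<close> is a function from a finite index type with \<open>k\<close> elements to \<open>int\<close>.\<close>

definition nondecreasing_in_each_variable :: "(('k::finite \<Rightarrow> int) \<Rightarrow> int) \<Rightarrow> bool" where
  "nondecreasing_in_each_variable \<phi> \<longleftrightarrow> (\<forall>m j. mono (\<lambda>t. \<phi> (m(j := t))))"

definition dyadic_basis ::
  "('d::finite \<Rightarrow> ('k::finite \<Rightarrow> int) \<Rightarrow> int) \<Rightarrow> (real ^ 'd) set set" where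
  "dyadic_basis \<Phi> = {R. dyadic_interval R \<and> (\<exists>m. has_dimensions R (\<lambda>i. 2 powi \<Phi> i m))}"

lemma L_log_L_0:
  "(L_log_L 0 :: (real ^ 'd::finite \<Rightarrow> real) set) = {f. integrable lebesgue f}"
proof -
  have "\<bar>y\<bar> * (1 + log_plus \<bar>y\<bar>) powr 0 = \<bar>y\<bar>" for y :: real
  proof -
    have "1 + log_plus \<bar>y\<bar> > 0" by (simp add: log_plus_def add_pos_nonneg)
    then show ?thesis by simp
  qed
  note eq = this
  show ?thesis
    unfolding L_log_L_def integrable_iff_bounded eq by simp
qed

lemma dyadic_factor_nonempty: "dyadic_factor j n \<noteq> {}"
  by (simp add: dyadic_factor_def)

lemma measure_dyadic_factor: "measure lborel (dyadic_factor j n) = 2 powi n"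
  by (simp add: dyadic_factor_def algebra_simps)

lemma box_of_inject:
  assumes "box_of I = box_of J" "\<And>i. I i \<noteq> {}"
  shows "I = J"
proof -
  define p where "p = (\<chi> i. SOME t. t \<in> I i)"
  have p: "p $ i \<in> I i" for i
    using assms(2)[of i] by (simp add: p_def some_in_eq)
  then have "p \<in> box_of J"
    using assms(1) by (auto simp: box_of_def)
  then have q: "p $ i \<in> J i" for i by (simp add: box_of_def)
  have "t \<in> I i \<longleftrightarrow> t \<in> J i" for i t
  proof -
    define x where "x = (\<chi> l. if l = i then t else p $ l)"
    have "x \<in> box_of I \<longleftrightarrow> t \<in> I i" "x \<in> box_of J \<longleftrightarrow> t \<in> J i"
      using p q by (auto simp: box_of_def x_def)
    with assms(1) show ?thesis by simp
  qed
  then show ?thesis by (intro ext) blast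
qed

lemma dyadic_basis_eq:
  "dyadic_basis \<Phi> = {box_of (\<lambda>i. dyadic_factor (j i) (\<Phi> i m)) | j m. True}"
proof (intro set_eqI iffI)
  fix R assume "R \<in> dyadic_basis \<Phi>"
  then obtain j n m I where R: "R = box_of (\<lambda>i. dyadic_factor (j i) (n i))" "R = box_of I"
    and I: "\<And>i. measure lborel (I i) = 2 powi \<Phi> i m"
    unfolding dyadic_basis_def dyadic_interval_def has_dimensions_def by blast
  have "(\<lambda>i. dyadic_factor (j i) (n i)) = I"
    using R by (intro box_of_inject) (simp_all add: dyadic_factor_nonempty)
  then have "2 powi n i = (2::real) powi \<Phi> i m" for i
    using I[of i] measure_dyadic_factor[of "j i" "n i"] by auto
  then have "n i = \<Phi> i m" for i
    using power_int_strict_increasing[of "n i" "\<Phi> i m" "2::real"]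
      power_int_strict_increasing[of "\<Phi> i m" "n i" "2::real"]
    by (cases "n i" "\<Phi> i m" rule: linorder_cases) auto
  then show "R \<in> {box_of (\<lambda>i. dyadic_factor (j i) (\<Phi> i m)) | j m. True}"
    using R by auto
next
  fix R assume "R \<in> {box_of (\<lambda>i. dyadic_factor (j i) (\<Phi> i m)) | j m. True}"
  then obtain j m where R: "R = box_of (\<lambda>i. dyadic_factor (j i) (\<Phi> i m))" by auto
  have "is_interval (dyadic_factor a b) \<and> bounded (dyadic_factor a b)" for a b
    by (simp add: dyadic_factor_def is_interval_co)
  then have "has_dimensions R (\<lambda>i. 2 powi \<Phi> i m)"
    unfolding has_dimensions_def
    by (intro exI[of _ "\<lambda>i. dyadic_factor (j i) (\<Phi> i m)"] conjI allI)
      (simp_all only: measure_dyadic_factor R)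
  then show "R \<in> dyadic_basis \<Phi>"
    using R by (auto simp: dyadic_basis_def dyadic_interval_def)
qed

lemma is_basis_dyadic_basis: "is_basis (dyadic_basis \<Phi>)"
  unfolding is_basis_def
proof
  fix R assume "R \<in> dyadic_basis \<Phi>"
  then obtain j m where R: "R = box_of (\<lambda>i. dyadic_factor (j i) (\<Phi> i m))"
    by (auto simp: dyadic_basis_eq)
  have "R \<subseteq> cbox (\<chi> i. of_int (j i) * 2 powi \<Phi> i m) (\<chi> i. (of_int (j i) + 1) * 2 powi \<Phi> i m)"
    by (auto simp: R box_of_def dyadic_factor_def mem_box_cart less_imp_le)
  then have "bounded R" by (rule bounded_subset[OF bounded_cbox])
  moreover have "R = (\<Inter>i. (\<lambda>x. x $ i) -` dyadic_factor (j i) (\<Phi> i m))"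
    by (auto simp: R box_of_def)
  moreover have "(\<lambda>x::real^'a. x $ i) -` dyadic_factor a b \<in> sets borel" for i a b
    using measurable_sets[of "\<lambda>x::real^'a. x $ i" borel borel "dyadic_factor a b"]
    by (simp add: dyadic_factor_def)
  ultimately show "bounded R \<and> R \<in> sets lebesgue"
    by (simp add: sets.finite_INT)
qed

end

theory Submission
  imports Defs
begin

text \<open>
  Monotonicity puts no constraint on the values of \<open>\<Phi>\<close> along the antichain of points
  \<open>(a, - a)\<close> in two of the variables, so the (countably many) vectors of dyadic dimensions
  can all be placed there, and \<open>\<Phi>\<close> extends monotonically to the rest of the lattice. The
  basis then contains every dyadic interval, and a construction in the style of Saks applies. With
  \<open>d\<close> the dimension, let \<open>U\<close> be the union of the boxes of volume \<open>2 ^ (- N)\<close> with sides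
  \<open>2 ^ (- n\<^sub>i)\<close> at a corner of the unit cube. It has measure at least of the order of
  \<open>N ^ (d - 1) * 2 ^ (- N)\<close>, and all these boxes contain the cube \<open>Q\<close> of side
  \<open>2 ^ (- N)\<close>. Hence the function \<open>K * 2 ^ (N * (d - 1))\<close> on \<open>Q\<close> has average
  \<open>K\<close> over each of the boxes, while its \<open>L (log L) ^ (d - 2)\<close> integral is of the order of
  \<open>N ^ (d - 2) * 2 ^ (- N)\<close>, smaller than the measure of \<open>U\<close> by a factor \<open>N\<close>.
  Copies of \<open>U\<close> repeated periodically at the scales \<open>2 ^ (- (s + l * N))\<close> are independent,
  so about \<open>1 / |U|\<close> of them cover most of the cube at small total cost. The counterexample is
  the supremum of such functions, with \<open>K\<close> tending to infinity.
\<close>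

subsection \<open>Monotone interpolation from an antichain\<close>

text \<open>A point with \<open>a + b >= 0\<close> dominates exactly the antidiagonal points
  \<open>(c, - c)\<close> with \<open>-b <= c <= a\<close>, and one with \<open>a + b < 0\<close> is
  dominated by those with \<open>a <= c <= -b\<close>. Taking the maximum of \<open>v\<close> over
  the former and the minimum over the latter is monotone because these ranges are nested.\<close>

lemma monotone_extension_of_antidiagonal:
  fixes v :: "int \<Rightarrow> int"
  obtains \<psi> :: "int \<Rightarrow> int \<Rightarrow> int"
  where "\<And>a a' b b'. a \<le> a' \<Longrightarrow> b \<le> b' \<Longrightarrow> \<psi> a b \<le> \<psi> a' b'" and "\<And>a. \<psi> a (- a) = v a"
proof
  define \<psi> where "\<psi> a b = (if a + b \<ge> 0 then Max (v ` {-b..a}) else Min (v ` {a..-b}))" for a b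
  show "\<psi> a (- a) = v a" for a
    by (simp add: \<psi>_def)
  show "\<psi> a b \<le> \<psi> a' b'" if "a \<le> a'" "b \<le> b'" for a a' b b'
  proof -
    consider "a + b \<ge> 0" | "a' + b' < 0" | "a + b < 0" "a' + b' \<ge> 0"
      by linarith
    then show ?thesis
    proof cases
      case 1
      then have "Max (v ` {-b..a}) \<le> Max (v ` {-b'..a'})"
        using that by (intro Max_mono) auto
      with 1 that show ?thesis by (simp add: \<psi>_def)
    next
      case 2
      then have "Min (v ` {a..-b}) \<le> Min (v ` {a'..-b'})"
        using that by (intro Min_antimono) auto
      with 2 that show ?thesis by (simp add: \<psi>_def)
    next
      case 3
      \<comment> \<open>The antidiagonal point \<open>(c, - c)\<close> lies between
        \<open>(a, b)\<close> and \<open>(a', b')\<close>, so \<open>v c\<close> separates the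
        minimum from the maximum.\<close>
      define c where "c = max a (- b')"
      have "Min (v ` {a..-b}) \<le> v c"
        using 3 that by (intro Min_le) (auto simp: c_def)
      also have "v c \<le> Max (v ` {-b'..a'})"
        using 3 that by (intro Max_ge) (auto simp: c_def)
      finally show ?thesis using 3 by (simp add: \<psi>_def)
    qed
  qed
qed

lemma all_dyadic_dimensions:
  assumes "2 \<le> CARD('k)"
  obtains \<Phi> :: "'d::finite \<Rightarrow> ('k::finite \<Rightarrow> int) \<Rightarrow> int"
  where "\<And>i. nondecreasing_in_each_variable (\<Phi> i)"
    and "\<And>R. dyadic_interval R \<Longrightarrow> R \<in> dyadic_basis \<Phi>"
proof -
  obtain k l :: 'k where kl: "k \<noteq> l"
    using assms by (metis One_nat_def card_1_singleton_iff card_eq_0_iff finite_code is_singletonI'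
        is_singleton_altdef not_numeral_le_zero numeral_le_one_iff semiring_norm(69) UNIV_I UNIV_not_empty)
  \<comment> \<open>Integer vectors indexed by a finite type are countable, so \<open>v\<close> runs
    through all of them; negative \<open>a\<close> merely repeat the vector with code 0.\<close>
  define v :: "int \<Rightarrow> 'd \<Rightarrow> int" where "v a = from_nat (nat a)" for a
  have "\<exists>\<psi>. (\<forall>a a' b b'. a \<le> a' \<longrightarrow> b \<le> b' \<longrightarrow> \<psi> a b \<le> \<psi> a' b') \<and> (\<forall>a. \<psi> a (- a) = v a i)" for i
    using monotone_extension_of_antidiagonal[of "\<lambda>a. v a i"] by metis
  then obtain \<psi> where mono: "\<And>i a a' b b'. a \<le> a' \<Longrightarrow> b \<le> b' \<Longrightarrow> \<psi> i a b \<le> \<psi> i a' b'"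
    and v: "\<And>i a. \<psi> i a (- a) = v a i"
    by metis
  show thesis
  proof
    show "nondecreasing_in_each_variable (\<lambda>m. \<psi> i (m k) (m l))" for i
      unfolding nondecreasing_in_each_variable_def
      by (auto intro!: monoI mono)
    show "R \<in> dyadic_basis (\<lambda>i m. \<psi> i (m k) (m l))" if interval: "dyadic_interval R" for R
    proof -
      obtain j n where R: "R = box_of (\<lambda>i. dyadic_factor (j i) (n i))"
        using interval by (auto simp: dyadic_interval_def)
      define m where "m = (\<lambda>_. int (to_nat n))(l := - int (to_nat n))"
      have "n = (\<lambda>i. \<psi> i (m k) (m l))"
        using kl by (simp add: m_def v) (simp add: v_def)
      then have "R = box_of (\<lambda>i. dyadic_factor (j i) (\<psi> i (m k) (m l)))"
        by (simp add: R fun_eq_iff)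
      then show ?thesis
        unfolding dyadic_basis_eq by blast
    qed
  qed
qed

subsection \<open>Dyadic digits\<close>

text \<open>This numbers the dyadic intervals of length 2^(-s). For \<open>t\<close> in [0, 1) it
  encodes the first \<open>s\<close> binary digits.\<close>

definition dyad :: "nat \<Rightarrow> real \<Rightarrow> int" where
  "dyad s t = \<lfloor>2 ^ s * t\<rfloor>"

definition unit_cube :: "(real ^ 'd::finite) set" where
  "unit_cube = box_of (\<lambda>i. {0..<1})"

text \<open>The shift by \<open>s\<close> binary digits in every coordinate: the relative position
  of \<open>x\<close> in its dyadic cell of side 2^(-s).\<close>

definition rescale :: "nat \<Rightarrow> real ^ 'd \<Rightarrow> real ^ 'd::finite" where
  "rescale s x = (\<chi> i. frac (2 ^ s * x $ i))"

lemma dyad_div: "dyad s t = dyad (s + k) t div 2 ^ k"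
proof -
  have "dyad s t = \<lfloor>(2 ^ (s + k) * t) / real_of_int (2 ^ k)\<rfloor>"
    by (simp add: dyad_def power_add)
  also have "\<dots> = dyad (s + k) t div 2 ^ k"
    by (subst floor_divide_real_eq_div) (simp_all add: dyad_def)
  finally show ?thesis .
qed

lemma dyad_eq_mono: 
  assumes "dyad s t = dyad s u" "r \<le> s"
  shows "dyad r t = dyad r u"
  using dyad_div[of r _ "s - r"] assms by simp

lemma dyadic_factor_eq: "dyadic_factor j (- int s) = {t. dyad s t = j}"
  by (auto simp: dyadic_factor_def dyad_def floor_eq_iff power_int_minus field_simps)

lemma dyad_0: "dyad 0 t = 0 \<longleftrightarrow> t \<in> {0..<1}"
  by (auto simp: dyad_def floor_eq_iff)

text \<open>Both sides say that the \<open>n\<close> digits after position \<open>s\<close> vanish.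
  This turns geometric conditions near the corner of a cell into digit conditions.\<close>

lemma frac_less_iff: "frac (2 ^ s * t) < 1 / 2 ^ n \<longleftrightarrow> dyad (s + n) t = 2 ^ n * dyad s t"
proof -
  have "real_of_int \<lfloor>2 ^ s * t\<rfloor> \<le> 2 ^ s * t" by simp
  then have "2 ^ n * real_of_int \<lfloor>2 ^ s * t\<rfloor> \<le> 2 ^ n * (2 ^ s * t)"
    by (rule mult_left_mono) simp
  then show ?thesis
    by (auto simp: dyad_def frac_def floor_eq_iff power_add field_simps)
qed

lemma unit_cube_iff: "x \<in> unit_cube \<longleftrightarrow> (\<forall>i. dyad 0 (x $ i) = 0)"
  by (simp add: unit_cube_def box_of_def dyad_0)

lemma rescale_in_unit_cube: "rescale s x \<in> unit_cube"
  by (simp add: unit_cube_def box_of_def rescale_def frac_lt_1)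

section \<open>Measurability and volume of boxes\<close>

lemma box_of_sets_borel:
  assumes "\<And>i. I i \<in> sets borel"
  shows "box_of I \<in> sets (borel :: (real ^ 'd::finite) measure)"
proof -
  have "box_of I = (\<Inter>i. (\<lambda>x. x $ i) -` I i)"
    by (auto simp: box_of_def)
  moreover have "(\<lambda>x::real^'d. x $ i) -` I i \<in> sets borel" for i
    using measurable_sets[of "\<lambda>x::real^'d. x $ i" borel borel "I i"] assms by simp
  ultimately show ?thesis by (simp add: sets.finite_INT)
qed

lemma measure_box_of:
  fixes a b :: "'d::finite \<Rightarrow> real"
  assumes "\<And>i. a i < b i"
  shows "measure lebesgue (box_of (\<lambda>i. {a i..<b i})) = (\<Prod>i\<in>UNIV. b i - a i)"
    and "box_of (\<lambda>i. {a i..<b i}) \<in> lmeasurable"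
proof -
  let ?B = "box_of (\<lambda>i. {a i..<b i})" and ?a = "\<chi> i. a i" and ?b = "\<chi> i. b i"
  have sub: "box ?a ?b \<subseteq> ?B" "?B \<subseteq> cbox ?a ?b"
    by (auto simp: box_of_def mem_box_cart less_imp_le)
  have meas: "?B \<in> sets lebesgue"
    using box_of_sets_borel[of "\<lambda>i. {a i..<b i}"] by simp
  show lm: "?B \<in> lmeasurable"
    using fmeasurableI2[OF lmeasurable_cbox sub(2) meas] .
  have "cbox ?a ?b \<noteq> {}"
    using assms by (auto simp: interval_ne_empty_cart less_imp_le)
  then have c: "measure lebesgue (cbox ?a ?b) = (\<Prod>i\<in>UNIV. b i - a i)"
    by (simp add: content_cbox_cart)
  have "measure lebesgue ?B \<le> measure lebesgue (cbox ?a ?b)"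
    by (rule measure_mono_fmeasurable[OF sub(2) meas lmeasurable_cbox])
  moreover have "measure lebesgue (box ?a ?b) \<le> measure lebesgue ?B"
    by (rule measure_mono_fmeasurable[OF sub(1) _ lm]) simp
  moreover have "measure lebesgue (box ?a ?b) = measure lebesgue (cbox ?a ?b)"
    by (simp add: measure_lborel_box_eq measure_lborel_cbox_eq)
  ultimately show "measure lebesgue ?B = (\<Prod>i\<in>UNIV. b i - a i)"
    using c by linarith
qed

lemma measure_dyadic_box:
  fixes j n :: "'d::finite \<Rightarrow> int"
  shows "measure lebesgue (box_of (\<lambda>i. dyadic_factor (j i) (n i))) = (\<Prod>i\<in>UNIV. 2 powi n i)"
    and "box_of (\<lambda>i. dyadic_factor (j i) (n i)) \<in> lmeasurable"
  unfolding dyadic_factor_def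
  by (subst measure_box_of; simp add: algebra_simps)
    (rule measure_box_of; simp add: algebra_simps)

lemma dyadic_interval_measure:
  assumes "dyadic_interval R"
  shows "R \<in> lmeasurable" and "0 < measure lebesgue R"
  using assms by (auto simp: dyadic_interval_def measure_dyadic_box intro!: prod_pos)

lemma measure_unit_cube:
  "measure lebesgue (unit_cube :: (real ^ 'd::finite) set) = 1"
  "(unit_cube :: (real ^ 'd::finite) set) \<in> lmeasurable"
  unfolding unit_cube_def by (subst measure_box_of; simp) (rule measure_box_of; simp)

lemma unit_cube_dyad: "x \<in> unit_cube \<longleftrightarrow> (\<forall>i. dyad s (x $ i) \<in> {0..<2 ^ s})"
proof -
  have "dyad 0 t = 0 \<longleftrightarrow> dyad s t \<in> {0..<2 ^ s}" for t
  proof -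
    have "(0::int) < 2 ^ s" by simp
    then show ?thesis
      unfolding dyad_div[of 0 t s] add_0 zdiv_eq_0_iff atLeastLessThan_iff by (smt (verit))
  qed
  then show ?thesis by (simp add: unit_cube_iff)
qed

subsection \<open>Independence of digit blocks\<close>

text \<open>On a single cell of side 2^(-s), \<open>rescale s\<close> is an affine bijection onto
  the unit cube; the map on the left is its inverse.\<close>

lemma affine_image_eq:
  fixes B :: "(real ^ 'd::finite) set" and j :: "'d \<Rightarrow> int"
  assumes "B \<subseteq> unit_cube"
  shows "(\<lambda>x. (1 / 2 ^ s) *\<^sub>R x + (\<chi> i. of_int (j i) / 2 ^ s)) ` B
    = {x. (\<lambda>i. dyad s (x $ i)) = j \<and> rescale s x \<in> B}" (is "?T ` B = ?C")
proof (intro equalityI subsetI)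
  fix x assume "x \<in> ?T ` B"
  then obtain b where b: "b \<in> B" and x: "x = ?T b" by blast
  have b01: "0 \<le> b $ i \<and> b $ i < 1" for i
    using b assms by (auto simp: unit_cube_def box_of_def)
  have eq: "2 ^ s * x $ i = b $ i + of_int (j i)" for i
    by (simp add: x field_simps)
  have "\<lfloor>b $ i\<rfloor> = 0" for i
    using b01[of i] by (simp add: floor_eq_iff)
  then have "(\<lambda>i. dyad s (x $ i)) = j" "rescale s x = b"
    by (simp_all add: dyad_def rescale_def eq frac_def fun_eq_iff vec_eq_iff)
  with b show "x \<in> ?C" by simp
next
  fix x assume "x \<in> ?C"
  then have j: "\<And>i. \<lfloor>2 ^ s * x $ i\<rfloor> = j i" and r: "rescale s x \<in> B"
    by (auto simp: dyad_def fun_eq_iff)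
  have "x = ?T (rescale s x)"
    by (simp add: vec_eq_iff rescale_def frac_def j diff_divide_distrib)
  with r show "x \<in> ?T ` B" by blast
qed

text \<open>The set is a disjoint union of affine copies of \<open>B\<close>, one in each cell
  counted by \<open>J\<close>, and each copy shrinks the measure by 2^(-s * d).\<close>

lemma measure_grid_rescale_aux:
  fixes A :: "('d::finite \<Rightarrow> int) set" and s :: nat
  defines "J \<equiv> A \<inter> {j. \<forall>i. j i \<in> {0..<2 ^ s}}"
  assumes B: "B \<subseteq> unit_cube" "B \<in> lmeasurable"
  shows "{x \<in> unit_cube. (\<lambda>i. dyad s (x $ i)) \<in> A \<and> rescale s x \<in> B} \<in> lmeasurable" (is "?H \<in> _")
    and "measure lebesgue {x \<in> unit_cube. (\<lambda>i. dyad s (x $ i)) \<in> A \<and> rescale s x \<in> B}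
           = real (card J) / 2 ^ (s * CARD('d)) * measure lebesgue B"
proof -
  let ?C = "\<lambda>j. {x. (\<lambda>i. dyad s (x $ i)) = j \<and> rescale s x \<in> B}"
  have "{j :: 'd \<Rightarrow> int. \<forall>i. j i \<in> {0..<2 ^ s}} = (\<Pi>\<^sub>E i\<in>UNIV. {0..<2 ^ s})"
    by auto
  moreover have "finite (\<Pi>\<^sub>E i\<in>(UNIV :: 'd set). {0..<2 ^ s :: int})"
    by (rule finite_PiE) auto
  ultimately have fin: "finite J"
    by (simp add: J_def)
  have H: "?H = (\<Union>j\<in>J. ?C j)"
    unfolding unit_cube_dyad[of _ s] J_def by (auto simp: fun_eq_iff)
  have meas: "?C j \<in> lmeasurable" for j
  proof -
    let ?T = "\<lambda>x. (1 / 2 ^ s) *\<^sub>R x + (\<chi> i. of_int (j i) / 2 ^ s)"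
    have "?T differentiable_on B"
      unfolding differentiable_on_def differentiable_def
      by (rule derivative_eq_intros strip exI | simp)+
    then have "?T ` B \<in> sets lebesgue"
      using B(2) by (intro differentiable_image_in_sets_lebesgue) auto
    moreover have "emeasure lebesgue (?T ` B) < \<infinity>"
      using B(2) by (subst emeasure_lebesgue_affine)
        (auto simp: fmeasurable_def ennreal_mult_less_top ennreal_power)
    ultimately show ?thesis
      unfolding affine_image_eq[OF B(1), symmetric] by (rule fmeasurableI)
  qed
  have msr: "measure lebesgue (?C j) = 1 / 2 ^ (s * CARD('d)) * measure lebesgue B" for j
    unfolding affine_image_eq[OF B(1), symmetric]
    by (subst measure_lebesgue_affine) (simp add: power_mult power_one_over)
  show "?H \<in> lmeasurable"
    unfolding H using fin meas by (intro fmeasurable.finite_UN) auto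
  have "measure lebesgue ?H = (\<Sum>j\<in>J. measure lebesgue (?C j))"
    unfolding H using fin meas
    by (intro measure_UNION') (auto simp: pairwise_def disjnt_def)
  also have "\<dots> = real (card J) / 2 ^ (s * CARD('d)) * measure lebesgue B"
    by (simp only: msr) simp
  finally show "measure lebesgue ?H = real (card J) / 2 ^ (s * CARD('d)) * measure lebesgue B" .
qed

text \<open>The first \<open>s\<close> digits are independent of the later ones. Counting cells once
  for \<open>B\<close> and once for the whole cube removes the explicit cardinality.\<close>

lemma measure_grid_rescale:
  fixes A :: "('d::finite \<Rightarrow> int) set"
  assumes "B \<subseteq> unit_cube" "B \<in> lmeasurable"
  shows "measure lebesgue {x \<in> unit_cube. (\<lambda>i. dyad s (x $ i)) \<in> A \<and> rescale s x \<in> B}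
    = measure lebesgue {x \<in> unit_cube. (\<lambda>i. dyad s (x $ i)) \<in> A} * measure lebesgue B"
  using measure_grid_rescale_aux(2)[OF assms, of s A]
    measure_grid_rescale_aux(2)[OF order_refl measure_unit_cube(2), of s A]
  by (simp add: rescale_in_unit_cube measure_unit_cube)

subsection \<open>The union of the boxes of volume \<open>2 ^ (- N)\<close> at a corner\<close>

definition corner :: "nat \<Rightarrow> (real ^ 'd::finite) set" where
  "corner N = {x \<in> unit_cube. \<exists>n. (\<Sum>i\<in>UNIV. n i) = N \<and> (\<forall>i. x $ i < 1 / 2 ^ n i)}"

lemma corner_subset: "corner N \<subseteq> unit_cube"
  by (auto simp: corner_def)

lemma corner_lmeasurable: "(corner N :: (real ^ 'd::finite) set) \<in> lmeasurable"
proof -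
  let ?T = "{n :: 'd \<Rightarrow> nat. (\<Sum>i\<in>UNIV. n i) = N}"
  have "(corner N :: (real ^ 'd) set) = unit_cube \<inter> (\<Union>n\<in>?T. box_of (\<lambda>i. {..<1 / 2 ^ n i}))"
    by (auto simp: corner_def box_of_def)
  moreover have "(\<Union>n\<in>?T. box_of (\<lambda>i. {..<1 / 2 ^ n i})) \<in> sets lebesgue"
    using box_of_sets_borel[of "\<lambda>i. {..<1 / 2 ^ n i}" for n :: "'d \<Rightarrow> nat"]
    by (intro sets.countable_UN') auto
  ultimately show ?thesis
    by (simp add: fmeasurable_Int_fmeasurable measure_unit_cube)
qed

lemma rescale_corner_iff:
  "rescale s x \<in> corner N \<longleftrightarrow>
     (\<exists>n. (\<Sum>i\<in>UNIV. n i) = N \<and> (\<forall>i. dyad (s + n i) (x $ i) = 2 ^ n i * dyad s (x $ i)))"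
  using rescale_in_unit_cube[of s x] by (simp add: corner_def rescale_def frac_less_iff)

text \<open>The boxes of \<open>corner N\<close> overlap heavily, so each is replaced by its upper
  orthant (the upper half in every factor). These are disjoint, have volume 2^(-N - d), and are at
  least M^(d - 1) in number, since all exponents but one may be chosen freely below
  \<open>M\<close>.\<close>

lemma measure_corner_ge:
  "real M ^ (CARD('d) - 1) / 2 ^ (CARD('d) * M + CARD('d))
     \<le> measure lebesgue (corner (CARD('d) * M) :: (real ^ 'd::finite) set)"
proof -
  define N where "N = CARD('d) * M"
  define i0 :: 'd where "i0 = undefined"
  define I where "I = (\<Pi>\<^sub>E i\<in>UNIV - {i0}. {..<M})"
  \<comment> \<open>Coordinate \<open>i0\<close> takes up the remaining exponent. The subtraction is
    never truncated, since the free exponents add up to at most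
    \<open>(d - 1) * M <= N\<close>.\<close>
  define \<nu> where "\<nu> g i = (if i = i0 then N - (\<Sum>i\<in>UNIV - {i0}. g i) else g i)" for g i
  \<comment> \<open>Index 1 at level \<open>Suc n\<close> is the upper half [2^(-n-1), 2^(-n)) of
    [0, 2^(-n)).\<close>
  define A where "A g = box_of (\<lambda>i. dyadic_factor 1 (- int (Suc (\<nu> g i))))" for g :: "'d \<Rightarrow> nat"
  have fin: "finite I"
    unfolding I_def by (rule finite_PiE) auto
  have card: "card I = M ^ (CARD('d) - 1)"
    unfolding I_def by (subst card_PiE) (auto simp: card_Diff_singleton)
  have sum: "(\<Sum>i\<in>UNIV. \<nu> g i) = N" if "g \<in> I" for g
  proof -
    have "(\<Sum>i\<in>UNIV - {i0}. g i) \<le> (\<Sum>i\<in>UNIV - {i0}. M)"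
      using that by (intro sum_mono) (auto simp: I_def PiE_def Pi_def less_imp_le)
    also have "\<dots> \<le> N"
      by (simp add: N_def card_Diff_singleton)
    finally have le: "(\<Sum>i\<in>UNIV - {i0}. g i) \<le> N" .
    have "(\<Sum>i\<in>UNIV. \<nu> g i) = \<nu> g i0 + (\<Sum>i\<in>UNIV - {i0}. \<nu> g i)"
      by (rule sum.remove) auto
    also have "(\<Sum>i\<in>UNIV - {i0}. \<nu> g i) = (\<Sum>i\<in>UNIV - {i0}. g i)"
      by (intro sum.cong) (auto simp: \<nu>_def)
    finally show ?thesis
      using le by (simp add: \<nu>_def)
  qed
  have factor: "t \<in> dyadic_factor 1 (- int (Suc n)) \<longleftrightarrow> 1 / 2 ^ Suc n \<le> t \<and> t < 1 / 2 ^ n" for t n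
    unfolding dyadic_factor_def power_int_minus power_int_of_nat by (auto simp: field_simps)
  have disj: "g = h" if "g \<in> I" "h \<in> I" "x \<in> A g" "x \<in> A h" for g h x
  proof (rule PiE_ext[OF that(1,2)[unfolded I_def]])
    fix i assume i: "i \<in> UNIV - {i0}"
    have *: "1 / 2 ^ Suc (g i) \<le> x $ i" "x $ i < 1 / 2 ^ g i" "1 / 2 ^ Suc (h i) \<le> x $ i" "x $ i < 1 / 2 ^ h i"
      using that(3,4) i unfolding A_def box_of_def mem_Collect_eq factor by (auto simp: \<nu>_def dest: spec[of _ i])
    have "(1::real) / 2 ^ Suc (g i) < 1 / 2 ^ h i" "(1::real) / 2 ^ Suc (h i) < 1 / 2 ^ g i"
      using * by linarith+
    then have "(2::real) ^ h i < 2 ^ Suc (g i)" "(2::real) ^ g i < 2 ^ Suc (h i)"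
      by (simp_all add: field_simps)
    then have "h i < Suc (g i)" "g i < Suc (h i)"
      by (auto intro: power_less_imp_less_exp[of "2::real"])
    then show "g i = h i" by simp
  qed
  have msr: "measure lebesgue (A g) = 1 / 2 ^ (N + CARD('d))" if "g \<in> I" for g
  proof -
    have "measure lebesgue (A g) = (\<Prod>i\<in>UNIV. (1 / 2) ^ Suc (\<nu> g i))"
      unfolding A_def measure_dyadic_box
      by (simp only: power_int_minus power_int_of_nat power_one_over inverse_eq_divide)
    also have "\<dots> = (1 / 2) ^ (\<Sum>i\<in>UNIV. Suc (\<nu> g i))"
      by (rule power_sum[symmetric])
    also have "(\<Sum>i\<in>UNIV. Suc (\<nu> g i)) = N + CARD('d)"
      using sum[OF that] by (simp add: sum_Suc)
    finally show ?thesis by (simp add: power_one_over)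
  qed
  have sub: "(\<Union>g\<in>I. A g) \<subseteq> corner N"
  proof clarify
    fix g x assume g: "g \<in> I" and x: "x \<in> A g"
    then have *: "1 / 2 ^ Suc (\<nu> g i) \<le> x $ i" "x $ i < 1 / 2 ^ \<nu> g i" for i
      unfolding A_def box_of_def mem_Collect_eq factor by blast+
    have "0 \<le> x $ i" "x $ i < 1" for i
    proof -
      show "0 \<le> x $ i"
        by (rule order_trans[OF _ *(1)[of i]]) simp
      have "1 / 2 ^ \<nu> g i \<le> (1::real)" by (simp add: field_simps)
      with *(2)[of i] show "x $ i < 1" by linarith
    qed
    then show "x \<in> corner N"
      using sum[OF g] *(2) by (auto simp: corner_def unit_cube_def box_of_def)
  qed
  have "real M ^ (CARD('d) - 1) / 2 ^ (N + CARD('d)) = (\<Sum>g\<in>I. measure lebesgue (A g))"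
    by (simp add: msr card)
  also have "\<dots> = measure lebesgue (\<Union>g\<in>I. A g)"
    using fin disj unfolding A_def
    by (intro measure_UNION'[symmetric] measure_dyadic_box) (auto simp: pairwise_def disjnt_def)
  also have "\<dots> \<le> measure lebesgue (corner N :: (real ^ 'd) set)"
    using sub by (intro measure_mono_fmeasurable corner_lmeasurable)
      (auto intro!: sets.finite_UN fin fmeasurableD measure_dyadic_box simp: A_def)
  finally show ?thesis
    by (simp add: N_def)
qed

section \<open>Independent copies of the corner set at scales \<open>N\<close> digits apart\<close>

definition avoid :: "nat \<Rightarrow> nat \<Rightarrow> nat \<Rightarrow> (real ^ 'd::finite) set" where
  "avoid N s l = {x \<in> unit_cube. \<forall>k<l. rescale (s + k * N) x \<notin> corner N}"

text \<open>The event at scale \<open>s + k * N\<close> looks at no digit beyond the next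
  \<open>N\<close>, because every \<open>n i\<close> is at most \<open>N\<close>. So
  \<open>W l\<close> depends only on the first \<open>s + l * N\<close> digits, and the next event
  is independent of it and contributes one more factor.\<close>

lemma measure_avoid:
  fixes N s l :: nat
  defines "W \<equiv> avoid N s :: nat \<Rightarrow> (real ^ 'd::finite) set"
  shows "W l \<in> lmeasurable"
    and "measure lebesgue (W l) = (1 - measure lebesgue (corner N :: (real ^ 'd) set)) ^ l"
proof -
  have step: "\<exists>A. W l = {x \<in> unit_cube. (\<lambda>i. dyad (s + l * N) (x $ i)) \<in> A}" for l
  proof -
    have inv: "rescale (s + k * N) y \<in> corner N"
      if k: "k < l" and eq: "\<And>i. dyad (s + l * N) (x $ i) = dyad (s + l * N) (y $ i)"
        and x: "rescale (s + k * N) x \<in> corner N" for k and x y :: "real ^ 'd"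
    proof -
      obtain n where n: "(\<Sum>i\<in>UNIV. n i) = N"
        "\<And>i. dyad (s + k * N + n i) (x $ i) = 2 ^ n i * dyad (s + k * N) (x $ i)"
        using x unfolding rescale_corner_iff by blast
      have "k * N + N \<le> l * N"
        using mult_le_mono1[of "Suc k" l N] k by simp
      moreover have "n i \<le> N" for i
        using member_le_sum[of i UNIV n] n(1) by simp
      ultimately have "k * N + n i \<le> l * N" for i
        by (meson add_left_mono order_trans)
      then have "dyad (s + k * N + n i) (x $ i) = dyad (s + k * N + n i) (y $ i)"
        "dyad (s + k * N) (x $ i) = dyad (s + k * N) (y $ i)" for i
        using dyad_eq_mono[OF eq, of "s + k * N + n i" i] dyad_eq_mono[OF eq, of "s + k * N" i] k
        by simp_all
      then show ?thesis
        unfolding rescale_corner_iff using n by (intro exI[of _ n]) simp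
    qed
    \<comment> \<open>By \<open>inv\<close>, membership in \<open>W l\<close> is constant on cells,
      so \<open>W l\<close> is the full preimage of its own image under the digit map.\<close>
    let ?A = "(\<lambda>x i. dyad (s + l * N) (x $ i)) ` W l"
    have "x \<in> W l" if x: "x \<in> unit_cube" "(\<lambda>i. dyad (s + l * N) (x $ i)) \<in> ?A" for x
    proof -
      obtain y where y: "y \<in> W l" "\<And>i. dyad (s + l * N) (x $ i) = dyad (s + l * N) (y $ i)"
        using x(2) by (auto simp: fun_eq_iff)
      show ?thesis
        using y inv[OF _ y(2)] x(1) by (auto simp: W_def avoid_def)
    qed
    then have "W l = {x \<in> unit_cube. (\<lambda>i. dyad (s + l * N) (x $ i)) \<in> ?A}"
      by (auto simp: W_def avoid_def)
    then show ?thesis ..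
  qed
  have c: "unit_cube - corner N \<in> lmeasurable" "(unit_cube - corner N :: (real ^ 'd) set) \<subseteq> unit_cube"
    by (auto intro!: fmeasurable_Diff measure_unit_cube fmeasurableD corner_lmeasurable)
  have mc: "measure lebesgue (unit_cube - corner N :: (real ^ 'd) set)
     = 1 - measure lebesgue (corner N :: (real ^ 'd) set)"
    by (subst measurable_measure_Diff)
      (auto simp: measure_unit_cube corner_subset intro: fmeasurableD corner_lmeasurable)
  have "W l \<in> lmeasurable \<and>
      measure lebesgue (W l) = (1 - measure lebesgue (corner N :: (real ^ 'd) set)) ^ l"
  proof (induction l)
    case 0
    then show ?case by (simp add: W_def avoid_def measure_unit_cube)
  next
    case (Suc l)
    obtain A where A: "W l = {x \<in> unit_cube. (\<lambda>i. dyad (s + l * N) (x $ i)) \<in> A}"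
      using step by blast
    have "W (Suc l) = {x \<in> W l. rescale (s + l * N) x \<in> unit_cube - corner N}"
      by (auto simp: W_def avoid_def less_Suc_eq rescale_in_unit_cube)
    then have W: "W (Suc l) = {x \<in> unit_cube. (\<lambda>i. dyad (s + l * N) (x $ i)) \<in> A
        \<and> rescale (s + l * N) x \<in> unit_cube - corner N}"
      unfolding A by auto
    show ?case
      using measure_grid_rescale[OF c(2,1), of "s + l * N" A]
        measure_grid_rescale_aux(1)[OF c(2,1), of "s + l * N" A] Suc
      unfolding A[symmetric] W[symmetric] mc by simp
  qed
  then show "W l \<in> lmeasurable"
    and "measure lebesgue (W l) = (1 - measure lebesgue (corner N :: (real ^ 'd) set)) ^ l"
    by auto
qed

text \<open>The small cubes that carry the mass: at each of the \<open>L\<close> scales, the cube of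
  relative side 2^(-N) at the lower corner of every cell. The condition states that \<open>N\<close>
  digits vanish in every coordinate.\<close>

definition cores :: "nat \<Rightarrow> nat \<Rightarrow> nat \<Rightarrow> (real ^ 'd::finite) set" where
  "cores N s L =
     (\<Union>l<L. {x \<in> unit_cube. \<forall>i. dyad (s + l * N + N) (x $ i) = 2 ^ N * dyad (s + l * N) (x $ i)})"

lemma measure_cores:
  "(cores N s L :: (real ^ 'd::finite) set) \<in> lmeasurable"
  "measure lebesgue (cores N s L :: (real ^ 'd::finite) set) \<le> real L / 2 ^ (N * CARD('d))"
proof -
  let ?Q = "box_of (\<lambda>i. {0..<1 / 2 ^ N}) :: (real ^ 'd) set"
  have "1 / 2 ^ N \<le> (1::real)"
    by (simp add: field_simps)
  then have Q: "?Q \<subseteq> unit_cube"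
    by (auto simp: unit_cube_def box_of_def intro: less_le_trans)
  have lQ: "?Q \<in> lmeasurable"
    by (intro measure_box_of) simp
  have mQ: "measure lebesgue ?Q = 1 / 2 ^ (N * CARD('d))"
    by (subst measure_box_of) (simp_all add: power_mult power_one_over)
  let ?C = "\<lambda>t. {x :: real ^ 'd. x \<in> unit_cube \<and> (\<forall>i. dyad (t + N) (x $ i) = 2 ^ N * dyad t (x $ i))}"
  have C: "?C t = {x \<in> unit_cube. (\<lambda>i. dyad t (x $ i)) \<in> UNIV \<and> rescale t x \<in> ?Q}" for t
    by (auto simp: box_of_def rescale_def frac_less_iff)
  have lm: "?C t \<in> lmeasurable" for t
    unfolding C by (rule measure_grid_rescale_aux[OF Q lQ])
  have mC: "measure lebesgue (?C t) = 1 / 2 ^ (N * CARD('d))" for t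
    unfolding C measure_grid_rescale[OF Q lQ] mQ by (simp add: measure_unit_cube)
  show "(cores N s L :: (real ^ 'd) set) \<in> lmeasurable"
    unfolding cores_def using lm by (intro fmeasurable.finite_UN) auto
  have "measure lebesgue (\<Union>l<L. ?C (s + l * N)) \<le> (\<Sum>l<L. measure lebesgue (?C (s + l * N)))"
    by (intro measure_UNION_le fmeasurableD lm) auto
  then show "measure lebesgue (cores N s L :: (real ^ 'd) set) \<le> real L / 2 ^ (N * CARD('d))"
    by (simp add: cores_def mC)
qed

lemma mem_dyadic_box:
  "x \<in> box_of (\<lambda>i. dyadic_factor (j i) (- int (t i))) \<longleftrightarrow> (\<forall>i. dyad (t i) (x $ i) = j i)"
  unfolding dyadic_factor_eq by (simp add: box_of_def)

lemma diameter_dyadic_box_le: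
  fixes j :: "'d::finite \<Rightarrow> int" and t :: "'d \<Rightarrow> nat"
  assumes "\<And>i. s \<le> t i"
  shows "diameter (box_of (\<lambda>i. dyadic_factor (j i) (- int (t i)))) \<le> real CARD('d) / 2 ^ s"
proof (rule diameter_le)
  fix x y assume xy: "x \<in> box_of (\<lambda>i. dyadic_factor (j i) (- int (t i)))"
    "y \<in> box_of (\<lambda>i. dyadic_factor (j i) (- int (t i)))"
  have "\<bar>(x - y) $ i\<bar> \<le> 1 / 2 ^ s" for i
  proof -
    have "dyad s (x $ i) = dyad s (y $ i)"
      using xy assms[of i] unfolding mem_dyadic_box by (auto intro: dyad_eq_mono[of "t i" "x $ i" "y $ i"])
    then have "\<bar>2 ^ s * x $ i - 2 ^ s * y $ i\<bar> < 1"
      unfolding dyad_def by linarith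
    then have "2 ^ s * \<bar>(x - y) $ i\<bar> < 1"
      by (simp add: right_diff_distrib[symmetric] abs_mult)
    then show ?thesis by (simp add: field_simps)
  qed
  then have "(\<Sum>i\<in>UNIV. \<bar>(x - y) $ i\<bar>) \<le> (\<Sum>i\<in>(UNIV :: 'd set). 1 / 2 ^ s)"
    by (intro sum_mono) auto
  with norm_le_l1_cart[of "x - y"] show "norm (x - y) \<le> real CARD('d) / 2 ^ s"
    by simp
qed simp

text \<open>If some rescaling of \<open>x\<close> lands in the corner set, \<open>x\<close> lies in
  a box of relative volume 2^(-N) at the corner of its cell. That box contains the core cube of the
  cell, of relative volume 2^(-N * d), and the ratio of the two is the constant.\<close>

lemma dense_box_at_corner:
  fixes x :: "real ^ 'd::finite"
  assumes "x \<in> unit_cube - avoid N s L"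
  obtains R where "dyadic_interval R" and "x \<in> R" and "diameter R \<le> real CARD('d) / 2 ^ s"
    and "measure lebesgue R \<le> 2 ^ (N * (CARD('d) - 1)) * measure lebesgue (R \<inter> cores N s L)"
proof -
  obtain l where l: "l < L" and "rescale (s + l * N) x \<in> corner N" and x: "x \<in> unit_cube"
    using assms by (auto simp: avoid_def)
  define t where "t = s + l * N"
  obtain n where n: "(\<Sum>i\<in>UNIV. n i) = N" "\<And>i. dyad (t + n i) (x $ i) = 2 ^ n i * dyad t (x $ i)"
    using \<open>rescale (s + l * N) x \<in> corner N\<close> unfolding rescale_corner_iff t_def by blast
  have nN: "n i \<le> N" for i
    using member_le_sum[of i UNIV n] n(1) by simp
  \<comment> \<open>\<open>R\<close> fixes the \<open>n i\<close> vanishing digits of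
    \<open>x\<close> after position \<open>t\<close>, while \<open>Q\<close> asks for all
    \<open>N\<close> to vanish; \<open>n i <= N\<close> gives the inclusion.\<close>
  define R where "R = box_of (\<lambda>i. dyadic_factor (dyad (t + n i) (x $ i)) (- int (t + n i)))"
  define Q where "Q = box_of (\<lambda>i. dyadic_factor (2 ^ N * dyad t (x $ i)) (- int (t + N)))"
  have QR: "Q \<subseteq> R \<inter> cores N s L"
  proof
    fix y assume "y \<in> Q"
    then have y: "dyad (t + N) (y $ i) = 2 ^ N * dyad t (x $ i)" for i
      unfolding Q_def mem_dyadic_box by simp
    have yt: "dyad t (y $ i) = dyad t (x $ i)" for i
      using dyad_div[of t "y $ i" N] by (simp add: y)
    have "dyad (t + n i) (y $ i) = dyad (t + n i) (x $ i)" for i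
    proof -
      have "dyad (t + n i) (y $ i) = 2 ^ N * dyad t (x $ i) div 2 ^ (N - n i)"
        using dyad_div[of "t + n i" "y $ i" "N - n i"] nN[of i] by (simp add: y)
      also have "(2 :: int) ^ N = 2 ^ (N - n i) * 2 ^ n i"
        using nN[of i] by (simp flip: power_add)
      finally show ?thesis by (simp add: n(2) mult.assoc)
    qed
    then have "y \<in> R"
      unfolding R_def mem_dyadic_box by simp
    moreover have "y \<in> unit_cube"
      using x yt by (simp add: unit_cube_dyad[of _ t])
    then have "y \<in> cores N s L"
      using y yt l by (auto simp: cores_def t_def intro!: bexI[of _ l])
    ultimately show "y \<in> R \<inter> cores N s L"
      by blast
  qed
  have 1: "(2::real) powi - int m = (1 / 2) ^ m" for m
    by (simp add: power_int_minus power_one_over inverse_eq_divide)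
  have "measure lebesgue R = (1 / 2) ^ (\<Sum>i\<in>UNIV. t + n i)"
    unfolding R_def measure_dyadic_box 1 by (rule power_sum[symmetric])
  then have R: "measure lebesgue R = 1 / 2 ^ (t * CARD('d) + N)"
    by (simp add: sum.distrib n(1) power_one_over mult.commute)
  have "measure lebesgue Q = 1 / 2 ^ ((t + N) * CARD('d))"
    unfolding Q_def measure_dyadic_box 1 by (simp add: power_one_over power_mult)
  moreover have "(t + N) * CARD('d) = t * CARD('d) + N + N * (CARD('d) - 1)"
    by (cases "CARD('d)") (auto simp: algebra_simps)
  ultimately have "measure lebesgue R = 2 ^ (N * (CARD('d) - 1)) * measure lebesgue Q"
    by (simp add: R power_add)
  also have "measure lebesgue Q \<le> measure lebesgue (R \<inter> cores N s L)"
    using QR unfolding R_def Q_def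
    by (intro measure_mono_fmeasurable fmeasurable_Int_fmeasurable fmeasurableD measure_dyadic_box measure_cores)
  finally have "measure lebesgue R \<le> 2 ^ (N * (CARD('d) - 1)) * measure lebesgue (R \<inter> cores N s L)"
    by simp
  moreover have "diameter R \<le> real CARD('d) / 2 ^ s"
    unfolding R_def by (intro diameter_dyadic_box_le) (simp add: t_def)
  moreover have "x \<in> R"
    unfolding R_def mem_dyadic_box by simp
  moreover have "dyadic_interval R"
    unfolding R_def dyadic_interval_def
    by (intro exI[of _ "\<lambda>i. dyad (t + n i) (x $ i)"] exI[of _ "\<lambda>i. - int (t + n i)"] refl)
  ultimately show thesis
    by (intro that)
qed

text \<open>
  The cancellation \<open>2 ^ (N * d) = 2 ^ N * 2 ^ (N * (d - 1))\<close> and the loss of one power of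
  \<open>M\<close> in the exponent \<open>d - 2\<close> against \<open>d - 1\<close> make the cost decay like \<open>1 / M\<close>.
\<close>

lemma cost_bound:
  fixes D K M L t :: nat and p :: real
  assumes D: "2 \<le> D" and K: "K \<le> M" and M: "1 \<le> M"
    and p: "real M ^ (D - 1) / 2 ^ (D * M + D) \<le> p"
    and L: "real L \<le> (real t + 1) / p"
  defines "h \<equiv> K * 2 ^ (D * M * (D - 1))"
  shows "real h * (1 + log_plus (real h)) powr (real D - 2) * (real L / 2 ^ (D * M * D))
    \<le> real K * (real t + 1) * 2 ^ D * (2 * real D ^ 2) ^ (D - 2) / real M"
proof -
  define N where "N = D * M"
  have N: "1 \<le> N * D" "K \<le> N"
    using D M K by (auto simp: N_def intro: order_trans)
  have hN: "real h / 2 ^ (N * D) = real K / 2 ^ N"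
  proof -
    have "N * D = N + N * (D - 1)"
      using D by (cases D) auto
    then show ?thesis by (simp add: h_def N_def[symmetric] power_add)
  qed
  have p0: "0 < p"
    using M by (intro less_le_trans[OF _ p]) simp
  \<comment> \<open>Since \<open>K <= N < 2 ^ N\<close>, the height is at most
    \<open>2 ^ (N * D)\<close>, so its logarithm is linear in \<open>N\<close>. This is where
    \<open>K <= M\<close> enters.\<close>
  have "1 + log_plus (real h) \<le> 2 * real (N * D)"
  proof -
    have "real K \<le> 2 ^ N"
      using N(2) of_nat_less_two_power[of N, where 'a=real] by linarith
    then have "real h / 2 ^ (N * D) \<le> 1"
      unfolding hN by simp
    then have "real h \<le> 2 ^ (N * D)"
      by (simp add: divide_le_eq)
    then have "ln (real h) \<le> ln (2 ^ (N * D))" if "0 < h"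
      using that by (subst ln_le_cancel_iff) auto
    moreover have "ln (2 ^ (N * D)) = real (N * D) * ln 2"
      by (simp add: ln_realpow)
    moreover have "real (N * D) * ln 2 \<le> real (N * D) * 1"
      using ln_2_less_1 by (intro mult_left_mono) auto
    ultimately have "ln (real h) \<le> real (N * D)"
      by (cases "h = 0") auto
    then show ?thesis
      using N(1) unfolding log_plus_def by linarith
  qed
  then have "(1 + log_plus (real h)) powr (real D - 2) \<le> (2 * real (N * D)) powr (real D - 2)"
    using D by (intro powr_mono2) (auto simp: log_plus_def)
  also have "\<dots> = (2 * real (N * D)) ^ (D - 2)"
    using D N(1) by (subst powr_realpow[symmetric]) (auto simp: of_nat_diff)
  finally have log: "(1 + log_plus (real h)) powr (real D - 2) \<le> (2 * real (N * D)) ^ (D - 2)" .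
  have "real h * (1 + log_plus (real h)) powr (real D - 2) * (real L / 2 ^ (D * M * D))
      = (real K / 2 ^ N) * (1 + log_plus (real h)) powr (real D - 2) * real L"
    unfolding hN[symmetric] by (simp add: N_def)
  also have "\<dots> \<le> (real K / 2 ^ N) * (2 * real (N * D)) ^ (D - 2) * ((real t + 1) * (2 ^ (N + D) / real M ^ (D - 1)))"
  proof (intro mult_mono log)
    have "1 / p \<le> 2 ^ (N + D) / real M ^ (D - 1)"
      using p p0 M by (simp add: N_def field_simps)
    then have "(real t + 1) * (1 / p) \<le> (real t + 1) * (2 ^ (N + D) / real M ^ (D - 1))"
      by (intro mult_left_mono) auto
    with L show "real L \<le> (real t + 1) * (2 ^ (N + D) / real M ^ (D - 1))"
      by simp
  qed auto
  also have "\<dots> = real K * (real t + 1) * 2 ^ D * ((2 * real (N * D)) ^ (D - 2) / real M ^ (D - 1))"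
  proof -
    \<comment> \<open>Used with \<open>a\<close> equal to \<open>2 ^ N\<close>: the volume gain
      2^(-N) cancels the growth of the number of copies.\<close>
    have gen: "k / a * x * (u * (a * b / y)) = k * u * b * (x / y)" if "a \<noteq> 0" for k a x u b y :: real
      using that by (cases "y = 0") (simp_all add: field_simps)
    show ?thesis
      unfolding power_add by (rule gen) simp
  qed
  also have "(2 * real (N * D)) = 2 * real D ^ 2 * real M"
    by (simp add: N_def power2_eq_square)
  also have "(2 * real D ^ 2 * real M) ^ (D - 2) / real M ^ (D - 1) = (2 * real D ^ 2) ^ (D - 2) / real M"
  proof -
    have "D - 1 = Suc (D - 2)" using D by simp
    then have "real M ^ (D - 1) = real M * real M ^ (D - 2)" by simp
    then show ?thesis using M by (simp add: power_mult_distrib)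
  qed
  finally show ?thesis by simp
qed

text \<open>Each parameter controls one requirement: \<open>s\<close> the diameters,
  \<open>t\<close> the measure left uncovered, and \<open>M\<close>, chosen after both, the cost
  \<open>C / M\<close>. The good set \<open>B\<close> consists of the points that meet at least one
  of the \<open>L\<close> copies of the corner set.\<close>

lemma saks_stage:
  assumes D: "2 \<le> CARD('d::finite)" and e: "0 < (e::real)"
  shows "\<exists>(h::nat) S (B :: (real ^ 'd) set). S \<in> lmeasurable \<and> B \<in> sets lebesgue
    \<and> real h * (1 + log_plus (real h)) powr (real CARD('d) - 2) * measure lebesgue S \<le> e
    \<and> unit_cube - B \<in> lmeasurable \<and> measure lebesgue (unit_cube - B) \<le> e
    \<and> (\<forall>x\<in>B. \<exists>R. dyadic_interval R \<and> x \<in> R \<and> diameter R \<le> e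
        \<and> real K * measure lebesgue R \<le> real h * measure lebesgue (R \<inter> S))"
proof -
  let ?D = "CARD('d)"
  obtain s where "real ?D / e < 2 ^ s"
    using real_arch_pow[of 2 "real ?D / e"] by auto
  then have s: "real ?D / 2 ^ s \<le> e"
    using e by (simp add: field_simps)
  obtain t :: nat where "- ln e < real t"
    using reals_Archimedean2 by blast
  then have "exp (- real t) \<le> exp (ln e)"
    by (subst exp_le_cancel_iff) linarith
  then have t: "exp (- real t) \<le> e"
    using e by simp
  define C where "C = real K * (real t + 1) * 2 ^ ?D * (2 * real ?D ^ 2) ^ (?D - 2)"
  obtain m :: nat where m: "C / e < real m"
    using reals_Archimedean2 by blast
  define M where "M = max (max K m) 1"
  have M: "K \<le> M" "1 \<le> M" "m \<le> M"
    by (auto simp: M_def)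
  have "C / e < real M"
    using m M(3) by (meson less_le_trans of_nat_le_iff)
  then have CM: "C / real M \<le> e"
    using e M(2) by (simp add: field_simps)
  define N where "N = ?D * M"
  define p where "p = measure lebesgue (corner N :: (real ^ 'd) set)"
  have p: "real M ^ (?D - 1) / 2 ^ (?D * M + ?D) \<le> p"
    using measure_corner_ge[where 'd='d, of M] by (simp add: p_def N_def)
  have p0: "0 < p"
    using M(2) by (intro less_le_trans[OF _ p]) simp
  have p1: "p \<le> 1"
    unfolding p_def measure_unit_cube(1)[where 'd='d, symmetric]
    by (intro measure_mono_fmeasurable corner_subset fmeasurableD corner_lmeasurable measure_unit_cube)
  \<comment> \<open>With \<open>t / p\<close> copies, \<open>(1 - p) ^ L <= exp (- t)\<close>.
    Rounding up adds at most 1, hence at most \<open>1 / p\<close>, which explains the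
    \<open>t + 1\<close> in the cost.\<close>
  define L where "L = nat \<lceil>real t / p\<rceil>"
  have "real L \<le> real t / p + 1"
    using p0 by (simp add: L_def)
  also have "\<dots> \<le> (real t + 1) / p"
    using p0 p1 by (simp add: field_simps)
  finally have L: "real L \<le> (real t + 1) / p" .
  have "(1 - p) ^ L \<le> exp (- p) ^ L"
    using p1 exp_ge_add_one_self[of "- p"] by (intro power_mono) auto
  also have "\<dots> = exp (- (p * real L))"
    by (simp add: exp_of_nat_mult[symmetric] mult.commute)
  also have "\<dots> \<le> exp (- real t)"
  proof -
    have "real t / p \<le> real L"
      unfolding L_def by (rule real_nat_ceiling_ge)
    then show ?thesis using p0 by (simp add: field_simps)
  qed
  finally have avoid: "measure lebesgue (avoid N s L :: (real ^ 'd) set) \<le> e"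
    using t by (simp add: measure_avoid p_def)
  let ?h = "K * 2 ^ (N * (?D - 1)) :: nat" and ?S = "cores N s L :: (real ^ 'd) set"
    and ?B = "unit_cube - avoid N s L :: (real ^ 'd) set"
  have B: "unit_cube - ?B = avoid N s L"
    by (auto simp: avoid_def)
  have "real ?h * (1 + log_plus (real ?h)) powr (real ?D - 2) * measure lebesgue ?S
      \<le> real ?h * (1 + log_plus (real ?h)) powr (real ?D - 2) * (real L / 2 ^ (N * ?D))"
    by (intro mult_left_mono measure_cores) auto
  also have "\<dots> \<le> C / real M"
    using cost_bound[OF D M(1,2) p L] by (simp add: C_def N_def)
  finally have cost: "real ?h * (1 + log_plus (real ?h)) powr (real ?D - 2) * measure lebesgue ?S \<le> e"
    using CM by linarith
  have "\<exists>R. dyadic_interval R \<and> x \<in> R \<and> diameter R \<le> e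
        \<and> real K * measure lebesgue R \<le> real ?h * measure lebesgue (R \<inter> ?S)"
    if x: "x \<in> ?B" for x
  proof -
    obtain R where R: "dyadic_interval R" "x \<in> R" "diameter R \<le> real ?D / 2 ^ s"
      "measure lebesgue R \<le> 2 ^ (N * (?D - 1)) * measure lebesgue (R \<inter> ?S)"
      using dense_box_at_corner[OF x] by blast
    have "real K * measure lebesgue R \<le> real K * (2 ^ (N * (?D - 1)) * measure lebesgue (R \<inter> ?S))"
      by (intro mult_left_mono R) simp
    then show ?thesis
      using R s by (intro exI[of _ R]) (auto simp: mult.assoc)
  qed
  moreover have "?B \<in> sets lebesgue"
    by (intro sets.Diff fmeasurableD measure_unit_cube measure_avoid)
  ultimately show ?thesis
    using cost avoid measure_cores(1)[where 'd='d, of N s L] measure_avoid(1)[where 'd='d, of N s L]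
    by (intro exI[of _ ?h] exI[of _ ?S] exI[of _ ?B]) (auto simp only: B)
qed

subsection \<open>The counterexample function\<close>

text \<open>
  The stages have integer heights so that a finite supremum is attained: the supremum of the stages
  then satisfies the same Orlicz bound as their sum, without any doubling argument.
\<close>

lemma SUP_ennreal_nat_attained:
  fixes G :: "nat \<Rightarrow> nat"
  assumes "(SUP r. ennreal (real (G r))) < \<infinity>"
  obtains r where "(SUP r. ennreal (real (G r))) = ennreal (real (G r))"
proof -
  obtain c where c: "0 \<le> c" "(SUP r. ennreal (real (G r))) = ennreal c"
    using assms by (cases "SUP r. ennreal (real (G r))") auto
  have "real (G r) \<le> c" for r
    using SUP_upper[of r UNIV "\<lambda>r. ennreal (real (G r))"] c by simp
  then have "range G \<subseteq> {..nat \<lfloor>c\<rfloor>}"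
    by (auto simp: le_nat_floor)
  then have fin: "finite (range G)"
    using finite_subset by blast
  then have "Max (range G) \<in> range G"
    by (intro Max_in) auto
  then obtain r where r: "G r = Max (range G)"
    by (metis imageE)
  have "(SUP r. ennreal (real (G r))) = ennreal (real (G r))"
    using fin r by (intro antisym SUP_least SUP_upper) (auto intro!: ennreal_leI)
  then show thesis by (rule that)
qed

text \<open>Stage \<open>r\<close> has target average \<open>r\<close> and tolerance 2^(-r-1), so
  the costs sum to at most 1, while almost every point of the cube lies in good sets
  \<open>B r\<close> with \<open>r\<close> arbitrarily large.\<close>

lemma saks_function:
  assumes D: "2 \<le> CARD('d::finite)"
  obtains f :: "real ^ 'd \<Rightarrow> real"
  where "f \<in> L_log_L (real CARD('d) - 2)"
    and "AE x in lebesgue. x \<in> unit_cube \<longrightarrow> (\<forall>k. \<exists>R. dyadic_interval R \<and> x \<in> R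
      \<and> diameter R \<le> (1 / 2) ^ k \<and> real k \<le> 1 / measure lebesgue R * (LINT y:R|lebesgue. f y))"
proof -
  define \<alpha> where "\<alpha> = real CARD('d) - 2"
  define \<psi> where "\<psi> u = \<bar>u\<bar> * (1 + log_plus \<bar>u\<bar>) powr \<alpha>" for u
  define P where "P r h S B \<longleftrightarrow> S \<in> lmeasurable \<and> B \<in> sets lebesgue
    \<and> real h * (1 + log_plus (real h)) powr (real CARD('d) - 2) * measure lebesgue S \<le> (1 / 2) ^ Suc r
    \<and> unit_cube - B \<in> lmeasurable \<and> measure lebesgue (unit_cube - B) \<le> (1 / 2) ^ Suc r
    \<and> (\<forall>x\<in>B. \<exists>R. dyadic_interval R \<and> x \<in> R \<and> diameter R \<le> (1 / 2) ^ Suc r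
        \<and> real r * measure lebesgue R \<le> real h * measure lebesgue (R \<inter> S))"
    for r h :: nat and S B :: "(real ^ 'd) set"
  have "\<exists>h S B. P r h S B" for r
    unfolding P_def by (rule saks_stage[OF D]) simp
  then obtain h S B where P: "\<And>r. P r (h r) (S r) (B r)"
    by metis
  note P = P[unfolded P_def]
  have S: "S r \<in> lmeasurable"
    and cost: "real (h r) * (1 + log_plus (real (h r))) powr (real CARD('d) - 2) * measure lebesgue (S r)
      \<le> (1 / 2) ^ Suc r"
    and mB: "unit_cube - B r \<in> lmeasurable" "measure lebesgue (unit_cube - B r) \<le> (1 / 2) ^ Suc r"
    for r
    using P[of r] by blast+
  have S' [measurable]: "S r \<in> sets lebesgue" for r
    using S by (rule fmeasurableD)
  define G where "G x r = (if x \<in> S r then h r else 0)" for x r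
  define F where "F x = (SUP r. ennreal (real (G x r)))" for x
  \<comment> \<open>Where the supremum is infinite, \<open>f\<close> takes the value 0; this happens
    only on a null set (\<open>F_fin\<close>).\<close>
  define f where "f x = enn2real (F x)" for x
  have G: "real (G x r) = real (h r) * indicator (S r) x" for x r
    by (simp add: G_def)
  have Gm [measurable]: "(\<lambda>x. real (G x r)) \<in> borel_measurable lebesgue" for r
    unfolding G by measurable
  have Fm [measurable]: "F \<in> borel_measurable lebesgue"
    unfolding F_def by measurable
  have fm: "f \<in> borel_measurable lebesgue"
    unfolding f_def by measurable
  \<comment> \<open>The exponent \<open>d - 2\<close> is nonnegative, so the Orlicz bound also
    controls the plain integral of \<open>F\<close>.\<close>
  have \<psi>_ge: "\<bar>u\<bar> \<le> \<psi> u" for u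
  proof -
    have "1 \<le> (1 + log_plus \<bar>u\<bar>) powr \<alpha>"
      using D by (intro ge_one_powr_ge_zero) (auto simp: log_plus_def \<alpha>_def)
    then show ?thesis
      using mult_left_mono[of 1 _ "\<bar>u\<bar>"] by (simp add: \<psi>_def)
  qed
  have \<psi>_nonneg: "0 \<le> \<psi> u" for u
    using \<psi>_ge[of u] by linarith
  have le_sum: "ennreal (\<psi> (real (G x r))) \<le> (\<Sum>r. ennreal (\<psi> (h r)) * indicator (S r) x)" for x r
  proof -
    have term_le: "a r \<le> suminf a" for a :: "nat \<Rightarrow> ennreal"
      using sum_le_suminf[of a "{r}"] by simp
    have "ennreal (\<psi> (real (G x r))) = ennreal (\<psi> (h r)) * indicator (S r) x"
      by (simp add: G_def \<psi>_def)
    also have "\<dots> \<le> (\<Sum>r. ennreal (\<psi> (h r)) * indicator (S r) x)"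
      by (rule term_le)
    finally show ?thesis .
  qed
  have sum_finite: "(\<integral>\<^sup>+ x. (\<Sum>r. ennreal (\<psi> (h r)) * indicator (S r) x) \<partial>lebesgue) < \<infinity>"
  proof -
    have "(\<integral>\<^sup>+ x. (\<Sum>r. ennreal (\<psi> (h r)) * indicator (S r) x) \<partial>lebesgue)
        = (\<Sum>r. \<integral>\<^sup>+ x. ennreal (\<psi> (h r)) * indicator (S r) x \<partial>lebesgue)"
      by (intro nn_integral_suminf) measurable
    also have "\<dots> = (\<Sum>r. ennreal (\<psi> (h r) * measure lebesgue (S r)))"
    proof (intro suminf_cong)
      fix r
      have "(\<integral>\<^sup>+ x. ennreal (\<psi> (h r)) * indicator (S r) x \<partial>lebesgue) = ennreal (\<psi> (h r)) * emeasure lebesgue (S r)"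
        using S' by (rule nn_integral_cmult_indicator)
      also have "\<dots> = ennreal (\<psi> (h r) * measure lebesgue (S r))"
        by (subst emeasure_eq_measure2[OF S]) (rule ennreal_mult'[symmetric], rule \<psi>_nonneg)
      finally show "(\<integral>\<^sup>+ x. ennreal (\<psi> (h r)) * indicator (S r) x \<partial>lebesgue)
        = ennreal (\<psi> (h r) * measure lebesgue (S r))" .
    qed
    also have "\<dots> \<le> (\<Sum>r. ennreal ((1 / 2) ^ Suc r))"
      using cost by (intro suminf_le ennreal_leI) (auto simp: \<psi>_def \<alpha>_def)
    also have "\<dots> = ennreal 1"
      by (rule suminf_ennreal_eq[OF _ power_half_series]) simp
    finally show ?thesis
      by (rule le_less_trans) simp
  qed
  have F_le: "F x \<le> (\<Sum>r. ennreal (\<psi> (h r)) * indicator (S r) x)" for x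
    unfolding F_def
  proof (rule SUP_least)
    fix r
    have "ennreal (real (G x r)) \<le> ennreal (\<psi> (real (G x r)))"
      using \<psi>_ge[of "real (G x r)"] by (intro ennreal_leI) simp
    with le_sum show "ennreal (real (G x r)) \<le> (\<Sum>r. ennreal (\<psi> (h r)) * indicator (S r) x)"
      by (rule order_trans[rotated])
  qed
  \<comment> \<open>A finite supremum equals the value of a single stage, whose \<psi> is one term
    of the sum.\<close>
  have \<psi>f_le: "ennreal (\<psi> (f x)) \<le> (\<Sum>r. ennreal (\<psi> (h r)) * indicator (S r) x)" for x
  proof (cases "F x < \<infinity>")
    case True
    then obtain r where "F x = ennreal (real (G x r))"
      unfolding F_def by (rule SUP_ennreal_nat_attained)
    then have "f x = real (G x r)"
      by (simp add: f_def)
    then show ?thesis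
      using le_sum by simp
  next
    case False
    then have "f x = 0"
      by (simp add: f_def less_top[symmetric])
    then show ?thesis by (simp add: \<psi>_def)
  qed
  have fL: "f \<in> L_log_L (real CARD('d) - 2)"
    using le_less_trans[OF nn_integral_mono[OF \<psi>f_le] sum_finite] fm
    by (simp add: L_log_L_def \<psi>_def \<alpha>_def)
  have F_int: "(\<integral>\<^sup>+ x. F x \<partial>lebesgue) < \<infinity>"
    using le_less_trans[OF nn_integral_mono[OF F_le] sum_finite] .
  have F_fin: "AE x in lebesgue. F x \<noteq> \<infinity>"
    using F_int by (intro nn_integral_PInf_AE Fm) auto
  have f_int: "integrable lebesgue f"
  proof (rule integrableI_bounded[OF fm])
    have "(\<integral>\<^sup>+ x. ennreal (norm (f x)) \<partial>lebesgue) \<le> (\<integral>\<^sup>+ x. F x \<partial>lebesgue)"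
      by (intro nn_integral_mono) (auto simp: f_def ennreal_enn2real_if)
    then show "(\<integral>\<^sup>+ x. ennreal (norm (f x)) \<partial>lebesgue) < \<infinity>"
      using F_int by (rule le_less_trans)
  qed
  have f_ge: "AE x in lebesgue. \<forall>r. real (G x r) \<le> f x"
    using F_fin
  proof eventually_elim
    case (elim x)
    show ?case
    proof
      fix r
      have "ennreal (real (G x r)) \<le> F x"
        unfolding F_def by (rule SUP_upper) simp
      with elim show "real (G x r) \<le> f x"
        unfolding f_def by (cases "F x") auto
    qed
  qed
  \<comment> \<open>Almost everywhere \<open>f\<close> dominates every single stage, so the density
    of \<open>S r\<close> in a box bounds the average of \<open>f\<close> from below.\<close>
  have average: "real (h r) * measure lebesgue (R \<inter> S r) \<le> (LINT y:R|lebesgue. f y)"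
    if "R \<in> sets lebesgue" for R r
  proof -
    have lm: "R \<inter> S r \<in> lmeasurable"
      using fmeasurable_Int_fmeasurable[OF S that] by (simp add: Int_commute)
    have "real (h r) * measure lebesgue (R \<inter> S r) = (LINT y|lebesgue. real (h r) * indicator (R \<inter> S r) y)"
      using lm by simp
    also have "\<dots> \<le> (LINT y|lebesgue. indicator R y *\<^sub>R f y)"
    proof (rule integral_mono_AE)
      show "integrable lebesgue (\<lambda>y. real (h r) * indicator (R \<inter> S r) y)"
        using lm by (intro integrable_mult_right integrable_real_indicator) (auto simp: fmeasurable_def)
      show "integrable lebesgue (\<lambda>y. indicator R y *\<^sub>R f y)"
        using that f_int by (rule integrable_mult_indicator)
      show "AE y in lebesgue. real (h r) * indicator (R \<inter> S r) y \<le> indicator R y *\<^sub>R f y"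
        using f_ge
      proof eventually_elim
        case (elim y)
        then have "real (h r) * indicator (S r) y \<le> f y"
          by (simp add: G)
        then show ?case
          by (auto simp: indicator_def)
      qed
    qed
    finally show ?thesis
      by (simp add: set_lebesgue_integral_def)
  qed
  \<comment> \<open>The intersection lies in every \<open>unit_cube - B r\<close> with
    \<open>r >= k\<close>, and these have measure tending to 0.\<close>
  have null: "(\<Inter>r\<in>{k..}. unit_cube - B r) \<in> null_sets lebesgue" for k
  proof -
    let ?I = "\<Inter>r\<in>{k..}. unit_cube - B r"
    have sets: "?I \<in> sets lebesgue"
      using mB(1) by (intro sets.countable_INT') (auto intro: fmeasurableD)
    have "measure lebesgue ?I \<le> (1 / 2) ^ r" if "k \<le> r" for r
    proof -
      have "measure lebesgue ?I \<le> measure lebesgue (unit_cube - B r)"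
        using that by (intro measure_mono_fmeasurable sets mB) auto
      also have "\<dots> \<le> (1 / 2) ^ Suc r" by (rule mB)
      also have "\<dots> \<le> (1 / 2) ^ r" by simp
      finally show ?thesis .
    qed
    then have "measure lebesgue ?I \<le> 0"
      by (intro tendsto_lowerbound[OF LIMSEQ_power_zero[of "1 / 2 :: real"]])
        (auto simp: eventually_at_top_linorder)
    moreover have "?I \<in> lmeasurable"
      by (rule fmeasurableI2[OF mB(1)[of k] _ sets]) auto
    ultimately show ?thesis
      using sets by (auto simp: null_sets_def emeasure_eq_measure2 measure_le_0_iff)
  qed
  have "AE x in lebesgue. \<forall>k. x \<notin> (\<Inter>r\<in>{k..}. unit_cube - B r)"
    using null by (subst AE_all_countable) (blast intro: AE_not_in)
  then have "AE x in lebesgue. x \<in> unit_cube \<longrightarrow> (\<forall>k. \<exists>R. dyadic_interval R \<and> x \<in> R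
      \<and> diameter R \<le> (1 / 2) ^ k \<and> real k \<le> 1 / measure lebesgue R * (LINT y:R|lebesgue. f y))"
  proof eventually_elim
    case (elim x)
    show ?case
    proof (intro impI allI)
      fix k assume "x \<in> unit_cube"
      with elim obtain r where r: "k \<le> r" "x \<in> B r"
        by auto
      then obtain R where R: "dyadic_interval R" "x \<in> R" "diameter R \<le> (1 / 2) ^ Suc r"
        "real r * measure lebesgue R \<le> real (h r) * measure lebesgue (R \<inter> S r)"
        using P[of r] by blast
      note R_measure = dyadic_interval_measure[OF R(1)]
      have "real k * measure lebesgue R \<le> real r * measure lebesgue R"
        using r(1) by (intro mult_right_mono) auto
      also have "\<dots> \<le> (LINT y:R|lebesgue. f y)"
        using R(4) average[OF fmeasurableD[OF R_measure(1)], of r] by linarith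
      finally have "real k \<le> 1 / measure lebesgue R * (LINT y:R|lebesgue. f y)"
        using R_measure(2) by (simp add: field_simps)
      moreover have "(1 / 2 :: real) ^ Suc r \<le> (1 / 2) ^ k"
        using r(1) by (intro power_decreasing) auto
      then have "diameter R \<le> (1 / 2) ^ k"
        using R(3) by linarith
      ultimately show "\<exists>R. dyadic_interval R \<and> x \<in> R \<and> diameter R \<le> (1 / 2) ^ k
          \<and> real k \<le> 1 / measure lebesgue R * (LINT y:R|lebesgue. f y)"
        using R(1,2) by blast
    qed
  qed
  with fL show thesis by (rule that)
qed

section \<open>Failure of differentiation\<close>

theorem theorem1p2:
  assumes "2 \<le> CARD('k::finite)" and "CARD('k) \<le> CARD('d::finite)"
  shows "\<exists>\<Phi> :: 'd \<Rightarrow> ('k \<Rightarrow> int) \<Rightarrow> int.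
           (\<forall>i. nondecreasing_in_each_variable (\<Phi> i)) \<and>
           \<not> differentiates (dyadic_basis \<Phi>) (L_log_L (real CARD('d) - 2))"
proof -
  obtain \<Phi> :: "'d \<Rightarrow> ('k \<Rightarrow> int) \<Rightarrow> int" where mono: "\<And>i. nondecreasing_in_each_variable (\<Phi> i)"
    and basis: "\<And>R. dyadic_interval R \<Longrightarrow> R \<in> dyadic_basis \<Phi>"
    using all_dyadic_dimensions[OF assms(1)] by blast
  have "2 \<le> CARD('d)"
    using assms by linarith
  then obtain f :: "real ^ 'd \<Rightarrow> real" where f: "f \<in> L_log_L (real CARD('d) - 2)"
    and bad: "AE x in lebesgue. x \<in> unit_cube \<longrightarrow> (\<forall>k. \<exists>R. dyadic_interval R \<and> x \<in> R
      \<and> diameter R \<le> (1 / 2) ^ k \<and> real k \<le> 1 / measure lebesgue R * (LINT y:R|lebesgue. f y))"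
    by (rule saks_function)
  have "\<not> differentiates (dyadic_basis \<Phi>) (L_log_L (real CARD('d) - 2))"
  proof
    assume "differentiates (dyadic_basis \<Phi>) (L_log_L (real CARD('d) - 2))"
    then have "AE x in lebesgue. \<forall>R :: nat \<Rightarrow> (real ^ 'd) set.
        (\<forall>j. R j \<in> dyadic_basis \<Phi> \<and> x \<in> R j) \<longrightarrow> (\<lambda>j. diameter (R j)) \<longlonglongrightarrow> 0 \<longrightarrow>
        (\<lambda>j. (1 / measure lebesgue (R j)) * (LINT y:R j|lebesgue. f y)) \<longlonglongrightarrow> f x"
      using f unfolding differentiates_def by blast
    \<comment> \<open>At almost every point of the cube there are boxes shrinking to it with
      averages at least \<open>k\<close>, which cannot converge to \<open>f x\<close>.
      Differentiation would thus force the cube to be null.\<close>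
    with bad have "AE x in lebesgue. x \<notin> (unit_cube :: (real ^ 'd) set)"
    proof eventually_elim
      case (elim x)
      show ?case
      proof
        assume "x \<in> unit_cube"
        then obtain R where R: "\<And>k. dyadic_interval (R k) \<and> x \<in> R k \<and> diameter (R k) \<le> (1 / 2) ^ k
            \<and> real k \<le> 1 / measure lebesgue (R k) * (LINT y:R k|lebesgue. f y)"
          using choice[OF mp[OF elim(1)]] by blast
        have "(\<lambda>k. diameter (R k)) \<longlonglongrightarrow> 0"
        proof (rule tendsto_sandwich[OF _ _ tendsto_const LIMSEQ_power_zero[of "1 / 2 :: real"]])
          have "bounded (R k)" for k
            using R basis is_basis_dyadic_basis unfolding is_basis_def by blast
          then show "\<forall>\<^sub>F k in sequentially. 0 \<le> diameter (R k)"
            by (simp add: diameter_ge_0)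
        qed (use R in auto)
        then have lim: "(\<lambda>k. 1 / measure lebesgue (R k) * (LINT y:R k|lebesgue. f y)) \<longlonglongrightarrow> f x"
          using elim(2) basis R by blast
        have "filterlim (\<lambda>k. 1 / measure lebesgue (R k) * (LINT y:R k|lebesgue. f y)) at_top sequentially"
          using filterlim_real_sequentially by (rule filterlim_at_top_mono) (use R in auto)
        with lim show False
          using not_tendsto_and_filterlim_at_infinity[OF sequentially_bot lim]
            filterlim_at_top_imp_at_infinity by blast
      qed
    qed
    then have "unit_cube \<in> null_sets (lebesgue :: (real ^ 'd) measure)"
      using measure_unit_cube(2)[where 'd='d] by (subst AE_iff_null_sets) (auto intro: fmeasurableD)
    then have "measure lebesgue (unit_cube :: (real ^ 'd) set) = 0"
      by (simp add: measure_eq_0_null_sets)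
    then show False
      by (simp add: measure_unit_cube)
  qed
  with mono show ?thesis by blast
qed

end
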